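(* Let $ABC$ be a triangle with $\gamma=|\overline{AB}|=\beta=|\overline{AC}|\neq\alpha=|\overline{BC}|$, with the side lengths $\alpha,\beta,\gamma$ integers and the area $E$ also an integer. Let $h$ be the height from the vertex $A$ to the side $\overline{BC}$. Then there exist positive integers $\delta,m,n$ with $m>n$, $(m,n)=1$ and $m+n\equiv 1\pmod 2$ such that either $$\alpha=2\delta(m^2-n^2),\quad h=\delta(2mn),\quad \gamma=\beta=\delta(m^2+n^2),$$ or alternatively $$\alpha=4\delta mn,\quad h=\delta(m^2-n^2),\quad \gamma=\beta=\delta(m^2+n^2).$$ Conversely, if the side lengths $\alpha,\beta,\gamma$ of a triangle $ABC$ satisfy, for some positive integers $\delta,m,n$ with $m>n$, either $\alpha=2\delta(m^2-n^2)$, $\gamma=\beta=\delta(m^2+n^2)$, or $\alpha=4\delta mn$, $\gamma=\beta=\delta(m^2+n^2)$, then $h=\delta(2mn)$ or $h=\delta(m^2-n^2)$ respectively, and the area $E$ is an integer.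
   Context: Triangles are (nondegenerate) triangles in the Euclidean plane; for a triangle $ABC$, the side lengths are $\alpha=|\overline{BC}|$, $\beta=|\overline{AC}|$, $\gamma=|\overline{AB}|$, $E$ denotes the area, and $h$ denotes the length of the altitude from $A$ to $\overline{BC}$. $(m,n)$ denotes the greatest common divisor of $m$ and $n$. In the converse part the conditions $(m,n)=1$ and $m+n\equiv1\pmod 2$ are not assumed. *)

theory Defs
  imports "HOL-Analysis.Analysis" "HOL-Number_Theory.Cong"
begin

definition altitude_foot :: "real ^ 2 \<Rightarrow> real ^ 2 \<Rightarrow> real ^ 2 \<Rightarrow> real ^ 2" where
  "altitude_foot A B C =
     (THE D. D \<in> affine hull {B, C} \<and> orthogonal (A - D) (C - B))"

lemma ex1_altitude_foot:
  fixes A B C :: "real ^ 2"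
  assumes "B \<noteq> C"
  shows "\<exists>!D. D \<in> affine hull {B, C} \<and> orthogonal (A - D) (C - B)"
proof -
  have nz: "(C - B) \<bullet> (C - B) \<noteq> 0"
    using assms by simp
  define t where "t = ((A - B) \<bullet> (C - B)) / ((C - B) \<bullet> (C - B))"
  have key: "orthogonal (A - (B + u *\<^sub>R (C - B))) (C - B) \<longleftrightarrow> u = t" for u
  proof -
    have "(A - (B + u *\<^sub>R (C - B))) \<bullet> (C - B)
            = (A - B) \<bullet> (C - B) - u * ((C - B) \<bullet> (C - B))"
      by (simp add: inner_diff_left inner_add_left)
    then show ?thesis
      using nz unfolding orthogonal_def t_def by (auto simp: eq_divide_eq)
  qed
  show ?thesis
  proof (rule ex1I[of _ "B + t *\<^sub>R (C - B)"])
    show "B + t *\<^sub>R (C - B) \<in> affine hull {B, C} \<and>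
          orthogonal (A - (B + t *\<^sub>R (C - B))) (C - B)"
      using key by (auto simp: affine_hull_2_alt)
  next
    fix D assume "D \<in> affine hull {B, C} \<and> orthogonal (A - D) (C - B)"
    then show "D = B + t *\<^sub>R (C - B)"
      using key by (auto simp: affine_hull_2_alt)
  qed
qed

definition altitude_length :: "real ^ 2 \<Rightarrow> real ^ 2 \<Rightarrow> real ^ 2 \<Rightarrow> real" where
  "altitude_length A B C = dist A (altitude_foot A B C)"

end

theory Submission
  imports Defs
begin

text \<open>
  In an isosceles triangle the altitude onto the base ends at the midpoint of the base, so
  half the base, the altitude and the leg form a right triangle:
  \<open>h\<^sup>2 = \<beta>\<^sup>2 - (\<alpha> / 2)\<^sup>2\<close> and \<open>E = \<alpha> h / 2\<close> (lemmas \<open>isosceles_altitude\<close> and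
  \<open>isosceles_area\<close>). The converse is then the identity
  \<open>(m\<^sup>2 + n\<^sup>2)\<^sup>2 = (m\<^sup>2 - n\<^sup>2)\<^sup>2 + (2 m n)\<^sup>2\<close>.

  For the direct part, \<open>\<alpha> / 2\<close> and \<open>h\<close> have to be integers, so that the right triangle is
  a Pythagorean triple. The altitude \<open>h = 2 E / \<alpha>\<close> is rational and \<open>(2 h)\<^sup>2 = 4 \<beta>\<^sup>2 - \<alpha>\<^sup>2\<close> is
  an integer, hence \<open>2 h\<close> is an integer; and in \<open>(2 h)\<^sup>2 + \<alpha>\<^sup>2 = 4 \<beta>\<^sup>2\<close> both summands are even
  squares, since a square is \<open>0\<close> or \<open>1\<close> modulo \<open>4\<close> (lemma \<open>isosceles_integral_right_triangle\<close>).
  The two cases of the conclusion are the two ways in which a Pythagorean triple can be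
  parametrised, according to which of its legs is \<open>2 \<delta> m n\<close> (lemma \<open>pythagorean_triple_cases\<close>).
\<close>

text \<open>
  The point \<open>(x/z, y/z)\<close> of the unit circle is determined by the slope \<open>y / (z + x)\<close> of the
  line joining it to \<open>(-1, 0)\<close>. With that slope written in lowest terms as \<open>n / m\<close>, the factorisation
  \<open>(z + x) (z - x) = y\<^sup>2\<close> gives \<open>z + x\<close>, \<open>z - x\<close> and \<open>y\<close> as multiples of \<open>m\<^sup>2\<close>, \<open>n\<^sup>2\<close> and
  \<open>m n\<close> by a common factor \<open>t\<close>. If \<open>m\<close> and \<open>n\<close> have different parity, then \<open>t\<close> is even and
  \<open>t / 2\<close> is the scale; if both are odd, the half sum and half difference of \<open>m\<close> and \<open>n\<close> take
  their place and the two legs change roles.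
\<close>
lemma pythagorean_triple_cases:
  fixes x y z :: int
  assumes pos: "x > 0" "y > 0" "z > 0" and pyth: "x\<^sup>2 + y\<^sup>2 = z\<^sup>2"
  obtains d m n where "d > 0" "m > n" "n > 0" "coprime m n" "odd (m + n)"
      "z = d * (m\<^sup>2 + n\<^sup>2)"
      "x = d * (m\<^sup>2 - n\<^sup>2) \<and> y = d * (2 * m * n) \<or> x = d * (2 * m * n) \<and> y = d * (m\<^sup>2 - n\<^sup>2)"
proof -
  define g where "g = gcd (z + x) y"
  have "g > 0" unfolding g_def using pos by (simp add: gcd_pos_int)
  obtain m n where m: "z + x = m * g" and n: "y = n * g" and cop: "coprime m n"
    using gcd_coprime_exists[of "z + x" y] \<open>g > 0\<close> unfolding g_def by auto
  have "m * g > 0" "n * g > 0" using m n pos by linarith+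
  then have "m > 0" "n > 0" using \<open>g > 0\<close> by (simp_all add: zero_less_mult_iff)
  have "y < z"
    by (rule power_less_imp_less_base[where n = 2])
       (use pos zero_less_power[of x 2] pyth in linarith)+
  then have "n * g < m * g" using m n pos by linarith
  then have "n < m" using \<open>g > 0\<close> by simp
  have "((z - x) * m) * g = (z - x) * (z + x)" by (simp add: m)
  also have "\<dots> = y\<^sup>2" using pyth by (simp add: algebra_simps power2_eq_square)
  also have "\<dots> = (n\<^sup>2 * g) * g" by (simp add: n power2_eq_square)
  finally have "((z - x) * m) * g = (n\<^sup>2 * g) * g" .
  then have zx: "(z - x) * m = n\<^sup>2 * g" using \<open>g > 0\<close> by simp
  then have "m dvd n\<^sup>2 * g" by (metis dvd_triv_right)
  moreover have "coprime m (n\<^sup>2)" using cop by simp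
  ultimately have "m dvd g" by (simp add: coprime_dvd_mult_right_iff)
  then obtain t where t: "g = m * t" by blast
  have "t > 0" using t \<open>g > 0\<close> \<open>m > 0\<close> by (simp add: zero_less_mult_iff)
  have sum: "z + x = m\<^sup>2 * t" and y: "y = m * n * t"
    using m n t by (simp_all add: power2_eq_square)
  have "(z - x) * m = (n\<^sup>2 * t) * m" using zx t by simp
  then have diff: "z - x = n\<^sup>2 * t" using \<open>m > 0\<close> by simp
  have z2: "2 * z = (m\<^sup>2 + n\<^sup>2) * t" and x2: "2 * x = (m\<^sup>2 - n\<^sup>2) * t"
    using sum diff by (simp_all add: algebra_simps)
  show thesis
  proof (cases "odd (m + n)")
    case True
    have "even ((m\<^sup>2 + n\<^sup>2) * t)" using z2 by (metis dvd_triv_left)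
    then have "even t" using True by simp
    then obtain d where d: "t = 2 * d" by blast
    show thesis
      by (rule that[of d n m, OF _ \<open>n < m\<close> \<open>n > 0\<close> cop True])
         (use d \<open>t > 0\<close> z2 x2 y in \<open>auto simp: algebra_simps\<close>)
  next
    case False
    \<comment> \<open>Coprime numbers of equal parity are both odd.\<close>
    have "odd m" "odd n" using False cop by (auto dest: coprime_common_divisor[of _ _ 2])
    then have "even (m + n)" "even (m - n)" by auto
    then obtain p q where "m + n = 2 * p" "m - n = 2 * q" by (meson dvdE)
    then have mn: "m = p + q" "n = p - q" by linarith+
    have "coprime p q"
    proof (rule coprimeI)
      fix c assume "c dvd p" "c dvd q"
      then show "is_unit c" using cop mn by (meson coprime_common_divisor dvd_add dvd_diff)
    qed
    moreover have "p > q" "q > 0" using mn \<open>n > 0\<close> \<open>n < m\<close> by linarith+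
    moreover have "odd (p + q)" using \<open>odd m\<close> mn by simp
    moreover have "z = t * (p\<^sup>2 + q\<^sup>2)" "x = t * (2 * p * q)" "y = t * (p\<^sup>2 - q\<^sup>2)"
      using z2 x2 y mn by (simp_all add: algebra_simps power2_eq_square)
    ultimately show thesis using that[of t q p] \<open>t > 0\<close> by blast
  qed
qed

text \<open>
  The midpoint \<open>M\<close> of \<open>BC\<close> is the foot of the altitude: \<open>C - B\<close> is twice the common vector from \<open>M\<close>
  to \<open>C\<close> and from \<open>B\<close> to \<open>M\<close>, and \<open>A\<close> has equal distances from \<open>B\<close> and \<open>C\<close>.
\<close>
lemma isosceles_altitude_foot:
  fixes A B C :: "real ^ 2"
  assumes "B \<noteq> C" "dist A B = dist A C"
  shows "altitude_foot A B C = midpoint B C"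
  unfolding altitude_foot_def
proof (rule the1_equality[OF ex1_altitude_foot[OF assms(1)]], intro conjI)
  show "midpoint B C \<in> affine hull {B, C}"
    unfolding affine_hull_2 midpoint_def
    by (intro CollectI exI[of _ "1 / 2"]) (simp add: algebra_simps)
  have "(A - B) \<bullet> (A - B) = (A - C) \<bullet> (A - C)"
    using assms(2) by (simp add: dist_norm norm_eq)
  then show "orthogonal (A - midpoint B C) (C - B)"
    unfolding orthogonal_def midpoint_def
    by (simp add: inner_simps inner_commute field_simps)
qed

text \<open>
  This is Pythagoras for half the base, in the form of the parallelogram law for the vectors
  from \<open>A\<close> to \<open>B\<close> and to \<open>C\<close>.
\<close>
lemma isosceles_altitude:
  fixes A B C :: "real ^ 2"
  assumes "B \<noteq> C" "dist A B = dist A C"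
  shows "(altitude_length A B C)\<^sup>2 = (dist A C)\<^sup>2 - (dist B C / 2)\<^sup>2"
proof -
  have "(A - B) \<bullet> (A - B) = (A - C) \<bullet> (A - C)"
    using assms(2) by (simp add: dist_norm norm_eq)
  moreover have "(altitude_length A B C)\<^sup>2 = (A - midpoint B C) \<bullet> (A - midpoint B C)"
    unfolding altitude_length_def isosceles_altitude_foot[OF assms]
    by (simp add: dist_norm power2_norm_eq_inner)
  ultimately show ?thesis
    unfolding midpoint_def
    by (simp add: dist_norm power2_norm_eq_inner power_divide inner_simps inner_commute field_simps)
qed

text \<open>
  With two equal sides, Heron's formula has the radicand
  \<open>(\<beta> + \<alpha> / 2) (\<beta> - \<alpha> / 2) (\<alpha> / 2)\<^sup>2\<close>, whose first two factors multiply to the square of the altitude.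
\<close>
lemma isosceles_area:
  fixes A B C :: "real ^ 2"
  assumes "B \<noteq> C" "dist A B = dist A C"
  shows "measure lborel (convex hull {A, B, C}) = dist B C * altitude_length A B C / 2"
proof -
  define a b h where "a = dist B C" and "b = dist A C" and "h = altitude_length A B C"
  have h: "h\<^sup>2 = b\<^sup>2 - (a / 2)\<^sup>2"
    unfolding a_def b_def h_def by (rule isosceles_altitude[OF assms])
  have "h \<ge> 0" unfolding h_def altitude_length_def by simp
  let ?s = "(a + b + b) / 2"
  have "measure lborel (convex hull {A, B, C}) = sqrt (?s * (?s - a) * (?s - b) * (?s - b))"
    using heron[of A B C] assms(2) unfolding a_def b_def by simp
  also have "?s * (?s - a) * (?s - b) * (?s - b) = (a / 2)\<^sup>2 * (b\<^sup>2 - (a / 2)\<^sup>2)"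
    by (simp add: field_simps power2_eq_square)
  also have "\<dots> = (a * h / 2)\<^sup>2"
    unfolding h[symmetric] by (simp add: power_mult_distrib power_divide)
  also have "sqrt \<dots> = a * h / 2"
    using \<open>h \<ge> 0\<close> unfolding a_def by (simp add: abs_mult)
  finally show ?thesis unfolding a_def h_def .
qed

text \<open>
  The altitude \<open>h\<close> and the area \<open>e\<close> make \<open>2 h\<close> the integer \<open>4 e / a\<close>, because
  \<open>(4 e)\<^sup>2 = a\<^sup>2 (4 b\<^sup>2 - a\<^sup>2)\<close> forces \<open>a\<close> to divide \<open>4 e\<close>. The two squares
  \<open>(2 h)\<^sup>2\<close> and \<open>a\<^sup>2\<close> add up to a multiple of \<open>4\<close>, so both roots are even.
\<close>
lemma isosceles_integral_right_triangle:
  fixes a b e :: int and h :: real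
  assumes "a > 0" and h: "h\<^sup>2 = (of_int b)\<^sup>2 - (of_int a / 2)\<^sup>2"
    and e: "of_int e = of_int a * h / 2"
  obtains x y where "a = 2 * x" "h = of_int y" "x\<^sup>2 + y\<^sup>2 = b\<^sup>2"
proof -
  have "of_int (4 * e) = of_int a * (2 * h)" using e by (simp add: field_simps)
  then have "(of_int (4 * e) :: real)\<^sup>2 = (of_int a)\<^sup>2 * (4 * h\<^sup>2)"
    by (simp only: power_mult_distrib) simp
  also have "\<dots> = of_int (a\<^sup>2 * (4 * b\<^sup>2 - a\<^sup>2))"
    unfolding h by (simp add: field_simps power_divide)
  finally have "(4 * e)\<^sup>2 = a\<^sup>2 * (4 * b\<^sup>2 - a\<^sup>2)"
    by (metis of_int_eq_iff of_int_power)
  then have "a\<^sup>2 dvd (4 * e)\<^sup>2" by simp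
  then have "a dvd 4 * e" by (subst (asm) pow_divides_pow_iff) simp_all
  then obtain k where k: "4 * e = a * k" by blast
  have "of_int a * (2 * h) = of_int (4 * e)" using e by (simp add: field_simps)
  also have "\<dots> = of_int a * (of_int k :: real)" using k by simp
  finally have hk: "2 * h = of_int k" using \<open>a > 0\<close> by simp
  have "(of_int (k\<^sup>2 + a\<^sup>2) :: real) = of_int (4 * b\<^sup>2)"
    using h by (simp add: hk[symmetric] power_mult_distrib power_divide)
  then have sum: "k\<^sup>2 + a\<^sup>2 = 4 * b\<^sup>2" by (simp only: of_int_eq_iff)
  have ka: "even k \<and> even a"
  proof (rule ccontr)
    assume "\<not> (even k \<and> even a)"
    moreover have "even (k\<^sup>2 + a\<^sup>2)" using sum by simp
    ultimately have "odd k" "odd a" by auto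
    then obtain u v where "k = 2 * u + 1" "a = 2 * v + 1" by (meson oddE)
    with sum have "4 * (u\<^sup>2 + u + v\<^sup>2 + v) + 2 = 4 * b\<^sup>2"
      by (simp add: power2_eq_square algebra_simps)
    then show False by presburger
  qed
  then obtain x y where xy: "a = 2 * x" "k = 2 * y" by (meson dvdE)
  show thesis
    by (rule that[of x y]) (use xy hk sum in \<open>auto simp: power_mult_distrib\<close>)
qed

theorem proposition2:
  fixes A B C :: "real ^ 2" and \<alpha> \<beta> \<gamma> h E :: real
  assumes triangle: "\<not> collinear {A, B, C}"
    and "\<alpha> = dist B C" and "\<beta> = dist A C" and "\<gamma> = dist A B"
    and "h = altitude_length A B C"
    and "E = measure lborel (convex hull {A, B, C})"
  shows
    "(\<gamma> = \<beta> \<and> \<beta> \<noteq> \<alpha> \<and> \<alpha> \<in> \<int> \<and> \<beta> \<in> \<int> \<and> \<gamma> \<in> \<int> \<and> E \<in> \<int> \<longrightarrow>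
       (\<exists>\<delta> m n :: int. \<delta> > 0 \<and> m > 0 \<and> n > 0 \<and> m > n \<and> gcd m n = 1 \<and> [m + n = 1] (mod 2) \<and>
          ((\<alpha> = of_int (2 * \<delta> * (m\<^sup>2 - n\<^sup>2)) \<and> h = of_int (\<delta> * (2 * m * n)) \<and>
            \<gamma> = \<beta> \<and> \<beta> = of_int (\<delta> * (m\<^sup>2 + n\<^sup>2))) \<or>
           (\<alpha> = of_int (4 * \<delta> * m * n) \<and> h = of_int (\<delta> * (m\<^sup>2 - n\<^sup>2)) \<and>
            \<gamma> = \<beta> \<and> \<beta> = of_int (\<delta> * (m\<^sup>2 + n\<^sup>2)))))) \<and>
     (\<forall>\<delta> m n :: int. \<delta> > 0 \<and> m > 0 \<and> n > 0 \<and> m > n \<longrightarrow>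
        (\<alpha> = of_int (2 * \<delta> * (m\<^sup>2 - n\<^sup>2)) \<and> \<gamma> = \<beta> \<and> \<beta> = of_int (\<delta> * (m\<^sup>2 + n\<^sup>2)) \<longrightarrow>
           h = of_int (\<delta> * (2 * m * n)) \<and> E \<in> \<int>) \<and>
        (\<alpha> = of_int (4 * \<delta> * m * n) \<and> \<gamma> = \<beta> \<and> \<beta> = of_int (\<delta> * (m\<^sup>2 + n\<^sup>2)) \<longrightarrow>
           h = of_int (\<delta> * (m\<^sup>2 - n\<^sup>2)) \<and> E \<in> \<int>))"
proof (intro conjI impI allI)
  have "B \<noteq> C" using triangle by auto
  then have "\<alpha> > 0" using assms by simp
  have "\<beta> > 0" using triangle assms by (auto simp: insert_commute)
  have "h \<ge> 0" using assms by (simp add: altitude_length_def)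
  have alt: "h\<^sup>2 = \<beta>\<^sup>2 - (\<alpha> / 2)\<^sup>2" and area: "E = \<alpha> * h / 2" if "\<gamma> = \<beta>"
    using isosceles_altitude[OF \<open>B \<noteq> C\<close>, of A] isosceles_area[OF \<open>B \<noteq> C\<close>, of A] that assms
    by simp_all
  {
    assume *: "\<gamma> = \<beta> \<and> \<beta> \<noteq> \<alpha> \<and> \<alpha> \<in> \<int> \<and> \<beta> \<in> \<int> \<and> \<gamma> \<in> \<int> \<and> E \<in> \<int>"
    then have "\<gamma> = \<beta>" by simp
    from * obtain a b e :: int where abe: "\<alpha> = of_int a" "\<beta> = of_int b" "E = of_int e"
      by (auto elim!: Ints_cases)
    have "a > 0" "b > 0" using \<open>\<alpha> > 0\<close> \<open>\<beta> > 0\<close> abe by simp_all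
    obtain x y where xy: "a = 2 * x" "h = of_int y" "x\<^sup>2 + y\<^sup>2 = b\<^sup>2"
      using isosceles_integral_right_triangle[OF \<open>a > 0\<close>, of h b e]
        alt[OF \<open>\<gamma> = \<beta>\<close>] area[OF \<open>\<gamma> = \<beta>\<close>] unfolding abe by blast
    have "x > 0" using xy \<open>a > 0\<close> by simp
    \<comment> \<open>The altitude vanishes only if the vertices are collinear, with \<open>A\<close> the midpoint of the base.\<close>
    have "h \<noteq> 0"
    proof
      assume "h = 0"
      then have "A = midpoint B C"
        using isosceles_altitude_foot[OF \<open>B \<noteq> C\<close>, of A] assms \<open>\<gamma> = \<beta>\<close>
        by (simp add: altitude_length_def)
      then have "{A, B, C} = {B, midpoint B C, C}" by auto
      then have "collinear {A, B, C}" by (simp only: collinear_midpoint)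
      with triangle show False by simp
    qed
    then have "y > 0" using xy \<open>h \<ge> 0\<close> by simp
    obtain d m n where "d > 0" "m > n" "n > 0" "coprime m n" "odd (m + n)"
        "b = d * (m\<^sup>2 + n\<^sup>2)"
        "x = d * (m\<^sup>2 - n\<^sup>2) \<and> y = d * (2 * m * n) \<or> x = d * (2 * m * n) \<and> y = d * (m\<^sup>2 - n\<^sup>2)"
      using pythagorean_triple_cases[OF \<open>x > 0\<close> \<open>y > 0\<close> \<open>b > 0\<close> xy(3)] by metis
    moreover from this have "m > 0" "gcd m n = 1" "[m + n = 1] (mod 2)"
      by (simp_all add: coprime_iff_gcd_eq_1 cong_def flip: odd_iff_mod_2_eq_one)
    ultimately show "\<exists>\<delta> m n :: int. \<delta> > 0 \<and> m > 0 \<and> n > 0 \<and> m > n \<and> gcd m n = 1 \<and> [m + n = 1] (mod 2) \<and>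
          ((\<alpha> = of_int (2 * \<delta> * (m\<^sup>2 - n\<^sup>2)) \<and> h = of_int (\<delta> * (2 * m * n)) \<and>
            \<gamma> = \<beta> \<and> \<beta> = of_int (\<delta> * (m\<^sup>2 + n\<^sup>2))) \<or>
           (\<alpha> = of_int (4 * \<delta> * m * n) \<and> h = of_int (\<delta> * (m\<^sup>2 - n\<^sup>2)) \<and>
            \<gamma> = \<beta> \<and> \<beta> = of_int (\<delta> * (m\<^sup>2 + n\<^sup>2))))"
      using xy(1,2) abe \<open>\<gamma> = \<beta>\<close>
      by (intro exI[of _ d] exI[of _ m] exI[of _ n]) auto
  }
  have converse: "h = of_int y \<and> E \<in> \<int>"
    if "\<alpha> = of_int (2 * x)" "\<gamma> = \<beta>" "\<beta> = of_int z" "x\<^sup>2 + y\<^sup>2 = z\<^sup>2" "y \<ge> 0" for x y z :: int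
  proof -
    have "h\<^sup>2 = of_int (z\<^sup>2 - x\<^sup>2)" using alt that by simp
    also have "z\<^sup>2 - x\<^sup>2 = y\<^sup>2" using that(4) by simp
    finally have "h = of_int y" using \<open>h \<ge> 0\<close> \<open>y \<ge> 0\<close> by simp
    moreover from this have "E = of_int (x * y)" using area that by simp
    ultimately show ?thesis by simp
  qed
  {
    fix \<delta> m n :: int
    assume pos: "\<delta> > 0 \<and> m > 0 \<and> n > 0 \<and> m > n"
    have legs: "\<delta> * (2 * m * n) \<ge> 0" "\<delta> * (m\<^sup>2 - n\<^sup>2) \<ge> 0"
      using pos by (simp_all add: power_mono)
    have pyth: "(\<delta> * (m\<^sup>2 - n\<^sup>2))\<^sup>2 + (\<delta> * (2 * m * n))\<^sup>2 = (\<delta> * (m\<^sup>2 + n\<^sup>2))\<^sup>2"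
      by (simp add: power2_eq_square algebra_simps)
    {
      assume "\<alpha> = of_int (2 * \<delta> * (m\<^sup>2 - n\<^sup>2)) \<and> \<gamma> = \<beta> \<and> \<beta> = of_int (\<delta> * (m\<^sup>2 + n\<^sup>2))"
      then have "h = of_int (\<delta> * (2 * m * n)) \<and> E \<in> \<int>"
        using converse[OF _ _ _ pyth legs(1)] by (simp add: mult.assoc)
      then show "h = of_int (\<delta> * (2 * m * n))" "E \<in> \<int>" by simp_all
    next
      assume "\<alpha> = of_int (4 * \<delta> * m * n) \<and> \<gamma> = \<beta> \<and> \<beta> = of_int (\<delta> * (m\<^sup>2 + n\<^sup>2))"
      then have "h = of_int (\<delta> * (m\<^sup>2 - n\<^sup>2)) \<and> E \<in> \<int>"
        using converse[OF _ _ _ pyth[unfolded add.commute[of "(\<delta> * (m\<^sup>2 - n\<^sup>2))\<^sup>2"]] legs(2)]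
        by (simp add: mult_ac)
      then show "h = of_int (\<delta> * (m\<^sup>2 - n\<^sup>2))" "E \<in> \<int>" by simp_all
    }
  }
qed

end
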